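(* Let $(X,d)$ be a complete semimetric space with a triangle function $\Phi\colon\mathbb{R}^+\times\mathbb{R}^+\to\mathbb{R}^+$ that is continuous at $(0,0)$ and satisfies the following two conditions. (1) $\Phi(ku,kv)=k\,\Phi(u,v)$ for all $k,u,v\in\mathbb{R}^+$. (2) For every $0\le a<1$ there exists $C(a)>0$ such that for every positive integer $p$ $$\Phi(1,\Phi(a,\Phi(a^2,\ldots,\Phi(a^{p-1},a^{p}))))\le C(a).$$ Let $T\colon X\to X$ be a mapping for which there exist real numbers $\alpha,\beta$ with $0\le\alpha<1$, $\beta\ge 0$ and $0\le\alpha+\beta<1$ such that $$d(Tx,Ty)\le \alpha\, d(x,y)+\beta\, d(x,Tx)\quad\text{for all } x,y\in X.$$ Then $T$ has a unique fixed point.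
   Context: $\mathbb{R}^+=[0,\infty)$. A semimetric space $(X,d)$ is a nonempty set $X$ with a function $d\colon X\times X\to\mathbb{R}^+$ such that for all $x,y\in X$: $d(x,y)=0$ if and only if $x=y$, and $d(x,y)=d(y,x)$. A function $\Phi\colon\mathbb{R}^+\times\mathbb{R}^+\to\mathbb{R}^+$ is a triangle function for $d$ if $\Phi$ is symmetric and non-decreasing in both of its arguments, $\Phi(0,0)=0$, and $d(x,y)\le\Phi(d(x,z),d(z,y))$ for all $x,y,z\in X$. A sequence $(x_n)$ in $X$ converges to $x\in X$ if $d(x_n,x)\to 0$; it is Cauchy if $d(x_n,x_m)\to 0$ as $n,m\to\infty$; $(X,d)$ is complete if every Cauchy sequence converges to some point of $X$. In condition (2) the expression is nested: for $p=1$ it is $\Phi(1,a)$, for $p=2$ it is $\Phi(1,\Phi(a,a^2))$, and so on. *)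

theory Defs
  imports "HOL-Analysis.Analysis"
begin

definition semimetric_space :: "'a set \<Rightarrow> ('a \<Rightarrow> 'a \<Rightarrow> real) \<Rightarrow> bool" where
  "semimetric_space X d \<longleftrightarrow>
     X \<noteq> {} \<and>
     (\<forall>x\<in>X. \<forall>y\<in>X. 0 \<le> d x y \<and> (d x y = 0 \<longleftrightarrow> x = y) \<and> d x y = d y x)"

definition semimetric_converges :: "('a \<Rightarrow> 'a \<Rightarrow> real) \<Rightarrow> (nat \<Rightarrow> 'a) \<Rightarrow> 'a \<Rightarrow> bool" where
  "semimetric_converges d s x \<longleftrightarrow> (\<lambda>n. d (s n) x) \<longlonglongrightarrow> 0"

definition semimetric_Cauchy :: "('a \<Rightarrow> 'a \<Rightarrow> real) \<Rightarrow> (nat \<Rightarrow> 'a) \<Rightarrow> bool" where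
  "semimetric_Cauchy d s \<longleftrightarrow>
     ((\<lambda>(n, m). d (s n) (s m)) \<longlongrightarrow> 0) (sequentially \<times>\<^sub>F sequentially)"

definition semimetric_complete :: "'a set \<Rightarrow> ('a \<Rightarrow> 'a \<Rightarrow> real) \<Rightarrow> bool" where
  "semimetric_complete X d \<longleftrightarrow>
     (\<forall>s. range s \<subseteq> X \<and> semimetric_Cauchy d s \<longrightarrow> (\<exists>x\<in>X. semimetric_converges d s x))"

text \<open>The domain and codomain $[0,\infty)$ of a triangle function are rendered by guards:
  values of \<open>\<Phi>\<close> at negative arguments are unconstrained and irrelevant.\<close>

definition triangle_function ::
    "'a set \<Rightarrow> ('a \<Rightarrow> 'a \<Rightarrow> real) \<Rightarrow> (real \<Rightarrow> real \<Rightarrow> real) \<Rightarrow> bool" where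
  "triangle_function X d \<Phi> \<longleftrightarrow>
     (\<forall>u\<ge>0. \<forall>v\<ge>0. 0 \<le> \<Phi> u v) \<and>
     (\<forall>u\<ge>0. \<forall>v\<ge>0. \<Phi> u v = \<Phi> v u) \<and>
     (\<forall>v\<ge>0. mono_on {0..} (\<lambda>u. \<Phi> u v)) \<and>
     (\<forall>u\<ge>0. mono_on {0..} (\<lambda>v. \<Phi> u v)) \<and>
     \<Phi> 0 0 = 0 \<and>
     (\<forall>x\<in>X. \<forall>y\<in>X. \<forall>z\<in>X. d x y \<le> \<Phi> (d x z) (d z y))"

text \<open>\<open>nested_powers \<Phi> a i p\<close> is
  $\Phi(a^i,\Phi(a^{i+1},\ldots,\Phi(a^{i+p-1},a^{i+p})))$, with \<open>p\<close> applications of \<open>\<Phi>\<close>.\<close>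

primrec nested_powers :: "(real \<Rightarrow> real \<Rightarrow> real) \<Rightarrow> real \<Rightarrow> nat \<Rightarrow> nat \<Rightarrow> real" where
  "nested_powers \<Phi> a i 0 = a ^ i"
| "nested_powers \<Phi> a i (Suc p) = \<Phi> (a ^ i) (nested_powers \<Phi> a (Suc i) p)"

lemma nested_powers_1: "nested_powers \<Phi> a 0 1 = \<Phi> 1 a"
  by simp

lemma nested_powers_2: "nested_powers \<Phi> a 0 2 = \<Phi> 1 (\<Phi> a (a\<^sup>2))"
  by (simp add: numeral_2_eq_2)

end

theory Submission
  imports Defs
begin

text \<open>
  The fixed point is the limit of the Picard iterates \<open>x\<^sub>n = (T ^^ n) x\<^sub>0\<close>. Taking \<open>y = T x\<close> in the
  contraction condition gives \<open>d (T x) (T (T x)) \<le> a * d x (T x)\<close> with \<open>a = \<alpha> + \<beta> < 1\<close>, so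
  consecutive iterates are at most \<open>D * a ^ n\<close> apart, where \<open>D = d x\<^sub>0 (T x\<^sub>0)\<close>. Unfolding the triangle inequality along the
  orbit bounds \<open>d (x\<^sub>i) (x\<^bsub>i+p+1\<^esub>)\<close> by \<open>D\<close> times the nested expression on \<open>a^i, \<dots>, a^(i+p)\<close>
  (\<open>dist_le_nested_powers\<close>); by homogeneity the factor \<open>a ^ i\<close> comes out of the nest
  (\<open>nested_powers_shift\<close>), and the assumed bound on the nest on
  \<open>1, a, \<dots>, a^p\<close> is independent of \<open>p\<close>. Hence the
  orbit is Cauchy (\<open>geometric_tail_imp_Cauchy\<close>) and has a limit \<open>x\<close>.

  The iterates also converge to \<open>T x\<close>, because
  \<open>d (x\<^bsub>n+1\<^esub>) (T x) \<le> \<alpha> * d (x\<^sub>n) x + \<beta> * d (x\<^sub>n) (x\<^bsub>n+1\<^esub>)\<close> tends to \<open>0\<close>. Limits are unique: homogeneity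
  and monotonicity turn \<open>\<Phi>\<close> into a relaxed ultrametric inequality with constant \<open>\<Phi> 1 1\<close>
  (\<open>triangle_function_le_max\<close>). So \<open>T x = x\<close>. Two fixed points \<open>x\<close>, \<open>y\<close> satisfy
  \<open>d x y \<le> \<alpha> * d x y\<close>, which forces \<open>x = y\<close>.
\<close>

lemma triangle_functionD:
  assumes "triangle_function X d \<Phi>"
  shows triangle_function_nonneg: "0 \<le> u \<Longrightarrow> 0 \<le> v \<Longrightarrow> 0 \<le> \<Phi> u v"
    and triangle_function_mono:
      "0 \<le> u \<Longrightarrow> u \<le> u' \<Longrightarrow> 0 \<le> v \<Longrightarrow> v \<le> v' \<Longrightarrow> \<Phi> u v \<le> \<Phi> u' v'"
    and triangle_function_ineq:
      "x \<in> X \<Longrightarrow> y \<in> X \<Longrightarrow> z \<in> X \<Longrightarrow> d x y \<le> \<Phi> (d x z) (d z y)"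
proof -
  show "0 \<le> u \<Longrightarrow> 0 \<le> v \<Longrightarrow> 0 \<le> \<Phi> u v"
    using assms by (auto simp: triangle_function_def)
  show "x \<in> X \<Longrightarrow> y \<in> X \<Longrightarrow> z \<in> X \<Longrightarrow> d x y \<le> \<Phi> (d x z) (d z y)"
    using assms by (auto simp: triangle_function_def)
  assume uv: "0 \<le> u" "u \<le> u'" "0 \<le> v" "v \<le> v'"
  have "mono_on {0..} (\<lambda>u. \<Phi> u v)" "mono_on {0..} (\<lambda>v. \<Phi> u' v)"
    using assms uv by (auto simp: triangle_function_def)
  then have "\<Phi> u v \<le> \<Phi> u' v" "\<Phi> u' v \<le> \<Phi> u' v'"
    using uv by (auto elim!: mono_onD)
  then show "\<Phi> u v \<le> \<Phi> u' v'"
    by (rule order_trans)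
qed

text \<open>Replacing both arguments by their maximum \<open>m\<close> and pulling \<open>m\<close> out of \<open>\<Phi> m m\<close> turns the
  triangle inequality into \<open>d x y \<le> K * max (d x z) (d z y)\<close> with \<open>K = \<Phi> 1 1\<close>.\<close>

lemma triangle_function_le_max:
  assumes \<Phi>: "triangle_function X d \<Phi>"
    and hom: "\<And>k u v. k \<ge> 0 \<Longrightarrow> u \<ge> 0 \<Longrightarrow> v \<ge> 0 \<Longrightarrow> \<Phi> (k * u) (k * v) = k * \<Phi> u v"
    and "0 \<le> u" "0 \<le> v"
  shows "\<Phi> u v \<le> max u v * \<Phi> 1 1"
proof -
  have "\<Phi> u v \<le> \<Phi> (max u v) (max u v)"
    using assms by (intro triangle_function_mono[OF \<Phi>]) auto
  also have "\<dots> = max u v * \<Phi> 1 1"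
    using hom[of "max u v" 1 1] assms by simp
  finally show ?thesis .
qed

lemma semimetric_converges_unique:
  assumes X: "semimetric_space X d" and \<Phi>: "triangle_function X d \<Phi>"
    and hom: "\<And>k u v. k \<ge> 0 \<Longrightarrow> u \<ge> 0 \<Longrightarrow> v \<ge> 0 \<Longrightarrow> \<Phi> (k * u) (k * v) = k * \<Phi> u v"
    and sX: "range s \<subseteq> X" and "x \<in> X" "y \<in> X"
    and "semimetric_converges d s x" "semimetric_converges d s y"
  shows "x = y"
proof -
  have le: "d x y \<le> max (d (s n) x) (d (s n) y) * \<Phi> 1 1" for n
  proof -
    have "s n \<in> X"
      using sX by auto
    then have "d x y \<le> \<Phi> (d x (s n)) (d (s n) y)" and "d x (s n) = d (s n) x"
      and "0 \<le> d (s n) x" "0 \<le> d (s n) y"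
      using triangle_function_ineq[OF \<Phi>] X assms(5,6) by (auto simp: semimetric_space_def)
    then show ?thesis
      using triangle_function_le_max[OF \<Phi> hom, of "d (s n) x" "d (s n) y"] by simp
  qed
  have "(\<lambda>n. max (d (s n) x) (d (s n) y) * \<Phi> 1 1) \<longlonglongrightarrow> max 0 0 * \<Phi> 1 1"
    using assms(7,8) unfolding semimetric_converges_def by (intro tendsto_intros)
  then have "d x y \<le> max 0 0 * \<Phi> 1 1"
    using le by (intro LIMSEQ_le_const) auto
  then have "d x y \<le> 0"
    by simp
  then show "x = y"
    using X assms(5,6) by (metis order_antisym semimetric_space_def)
qed

lemma nested_powers_nonneg:
  assumes "triangle_function X d \<Phi>" "0 \<le> a"
  shows "0 \<le> nested_powers \<Phi> a i p"
  using assms(2) by (induction p arbitrary: i) (auto intro: triangle_function_nonneg[OF assms(1)])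

text \<open>All powers in the nest starting at exponent \<open>i\<close> share the factor \<open>a ^ i\<close>, and homogeneity
  carries this factor through each layer of \<open>\<Phi>\<close>. Hence bounds for the nest that starts at exponent
  \<open>0\<close> control the nests that start anywhere.\<close>

lemma nested_powers_shift:
  assumes \<Phi>: "triangle_function X d \<Phi>"
    and hom: "\<And>k u v. k \<ge> 0 \<Longrightarrow> u \<ge> 0 \<Longrightarrow> v \<ge> 0 \<Longrightarrow> \<Phi> (k * u) (k * v) = k * \<Phi> u v"
    and a: "0 \<le> a"
  shows "nested_powers \<Phi> a (i + j) p = a ^ i * nested_powers \<Phi> a j p"
proof (induction p arbitrary: j)
  case 0
  then show ?case by (simp add: power_add)
next
  case (Suc p)
  have "nested_powers \<Phi> a (Suc (i + j)) p = a ^ i * nested_powers \<Phi> a (Suc j) p"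
    using Suc[of "Suc j"] by simp
  then show ?case
    using hom a nested_powers_nonneg[OF \<Phi> a] by (simp add: power_add)
qed

text \<open>The triangle inequality is applied with the intermediate point \<open>s (Suc i)\<close>, so that each
  step of the orbit contributes one layer of the nest; homogeneity collects the common scale \<open>D\<close>.\<close>

lemma dist_le_nested_powers:
  assumes X: "semimetric_space X d" and \<Phi>: "triangle_function X d \<Phi>"
    and hom: "\<And>k u v. k \<ge> 0 \<Longrightarrow> u \<ge> 0 \<Longrightarrow> v \<ge> 0 \<Longrightarrow> \<Phi> (k * u) (k * v) = k * \<Phi> u v"
    and sX: "range s \<subseteq> X" and a: "0 \<le> a" and D: "0 \<le> D"
    and step: "\<And>n. d (s n) (s (Suc n)) \<le> D * a ^ n"
  shows "d (s i) (s (Suc (i + p))) \<le> D * nested_powers \<Phi> a i p"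
proof (induction p arbitrary: i)
  case 0
  then show ?case using step by simp
next
  case (Suc p)
  have s: "s n \<in> X" for n
    using sX by auto
  then have nonneg: "0 \<le> d (s n) (s m)" for n m
    using X by (simp add: semimetric_space_def)
  have "d (s i) (s (Suc (i + Suc p)))
      \<le> \<Phi> (d (s i) (s (Suc i))) (d (s (Suc i)) (s (Suc (i + Suc p))))"
    by (intro triangle_function_ineq[OF \<Phi>] s)
  also have "\<dots> \<le> \<Phi> (D * a ^ i) (D * nested_powers \<Phi> a (Suc i) p)"
    using Suc[of "Suc i"] step nonneg by (intro triangle_function_mono[OF \<Phi>]) auto
  also have "\<dots> = D * nested_powers \<Phi> a i (Suc p)"
    using hom D a nested_powers_nonneg[OF \<Phi> a] by simp
  finally show ?case .
qed

lemma geometric_tail_imp_Cauchy: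
  assumes X: "semimetric_space X d" and sX: "range s \<subseteq> X"
    and a: "0 \<le> a" "a < 1" and M: "0 \<le> M"
    and tail: "\<And>i p. d (s i) (s (Suc (i + p))) \<le> M * a ^ i"
  shows "semimetric_Cauchy d s"
proof -
  have s: "s n \<in> X" for n
    using sX by auto
  have nonneg: "0 \<le> d (s n) (s m)" and sym: "d (s n) (s m) = d (s m) (s n)"
    and refl: "d (s n) (s n) = 0" for n m
    using X s by (auto simp: semimetric_space_def)
  have less: "d (s n) (s m) \<le> M * a ^ n" if "n < m" for n m
    using that tail by (metis less_iff_Suc_add)
  have pos: "0 \<le> M * a ^ n" for n
    using M a by simp
  (* The sum majorises the bound at the smaller index without a case distinction on which it is. *)
  have bound: "d (s n) (s m) \<le> M * a ^ n + M * a ^ m" for n m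
    using less[of n m] less[of m n] pos[of n] pos[of m] sym[of n m] refl[of n]
    by (cases n m rule: linorder_cases) auto
  have lim: "(\<lambda>n. M * a ^ n) \<longlonglongrightarrow> 0"
    using a LIMSEQ_power_zero[of a] by (intro tendsto_mult_right_zero) auto
  have "((\<lambda>z. M * a ^ fst z + M * a ^ snd z) \<longlongrightarrow> 0 + 0) (sequentially \<times>\<^sub>F sequentially)"
    by (intro tendsto_add filterlim_compose[OF lim] filterlim_fst filterlim_snd)
  then have "((\<lambda>z. M * a ^ fst z + M * a ^ snd z) \<longlongrightarrow> 0) (sequentially \<times>\<^sub>F sequentially)"
    by simp
  then have "((\<lambda>z. d (s (fst z)) (s (snd z))) \<longlongrightarrow> 0) (sequentially \<times>\<^sub>F sequentially)"
    by (rule tendsto_sandwich[OF _ _ tendsto_const, rotated -1]) (simp_all add: nonneg bound)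
  then show ?thesis
    by (simp add: semimetric_Cauchy_def case_prod_unfold)
qed

theorem theorem2p2:
  fixes X :: "'a set" and d :: "'a \<Rightarrow> 'a \<Rightarrow> real" and \<Phi> :: "real \<Rightarrow> real \<Rightarrow> real"
    and T :: "'a \<Rightarrow> 'a" and \<alpha> \<beta> :: real
  assumes "semimetric_space X d"
    and "semimetric_complete X d"
    and "triangle_function X d \<Phi>"
    and "continuous (at (0, 0) within {0..} \<times> {0..}) (\<lambda>(u, v). \<Phi> u v)"
    and "\<And>k u v. k \<ge> 0 \<Longrightarrow> u \<ge> 0 \<Longrightarrow> v \<ge> 0 \<Longrightarrow> \<Phi> (k * u) (k * v) = k * \<Phi> u v"
    and "\<And>a. 0 \<le> a \<Longrightarrow> a < 1 \<Longrightarrow> \<exists>C>0. \<forall>p\<ge>1. nested_powers \<Phi> a 0 p \<le> C"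
    and "T \<in> X \<rightarrow> X"
    and "0 \<le> \<alpha>" and "\<alpha> < 1" and "\<beta> \<ge> 0" and "0 \<le> \<alpha> + \<beta>" and "\<alpha> + \<beta> < 1"
    and "\<And>x y. x \<in> X \<Longrightarrow> y \<in> X \<Longrightarrow> d (T x) (T y) \<le> \<alpha> * d x y + \<beta> * d x (T x)"
  shows "\<exists>!x. x \<in> X \<and> T x = x"
proof -
  note X = assms(1) and \<Phi> = assms(3) and hom = assms(5) and contr = assms(13)
  have d: "0 \<le> d x y" "d x y = 0 \<longleftrightarrow> x = y" if "x \<in> X" "y \<in> X" for x y
    using X that by (auto simp: semimetric_space_def)
  define a where "a = \<alpha> + \<beta>"
  have a: "0 \<le> a" "a < 1"
    using assms(11,12) by (auto simp: a_def)
  obtain x0 where x0: "x0 \<in> X"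
    using X by (auto simp: semimetric_space_def)
  define s where "s n = (T ^^ n) x0" for n
  define D where "D = d x0 (T x0)"
  have s_Suc: "s (Suc n) = T (s n)" for n
    by (simp add: s_def)
  have s: "s n \<in> X" for n
    using assms(7) x0 by (induction n) (auto simp: s_def)
  then have sX: "range s \<subseteq> X"
    by auto
  have D: "0 \<le> D"
    using d(1)[OF s s, of 0 1] by (simp add: D_def s_def)
  have step: "d (s n) (s (Suc n)) \<le> D * a ^ n" for n
  proof (induction n)
    case 0
    then show ?case by (simp add: D_def s_def)
  next
    case (Suc n)
    have "d (s (Suc n)) (s (Suc (Suc n))) \<le> a * d (s n) (s (Suc n))"
      using contr[OF s s, of n "Suc n"] by (simp add: s_Suc a_def distrib_right)
    also have "\<dots> \<le> a * (D * a ^ n)"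
      using Suc a by (intro mult_left_mono)
    finally show ?case
      by (simp add: mult_ac)
  qed
  obtain C where C: "\<And>p. p \<ge> 1 \<Longrightarrow> nested_powers \<Phi> a 0 p \<le> C"
    using assms(6)[OF a] by blast
  (* C bounds the nests with at least one application of \<Phi>; the bare nest is a ^ 0 = 1. *)
  have nest: "nested_powers \<Phi> a 0 p \<le> max 1 C" for p
    using C[of p] by (cases p) (auto simp del: nested_powers.simps(2))
  have tail: "d (s i) (s (Suc (i + p))) \<le> (D * max 1 C) * a ^ i" for i p
  proof -
    have "d (s i) (s (Suc (i + p))) \<le> D * nested_powers \<Phi> a i p"
      using dist_le_nested_powers[OF X \<Phi> hom sX a(1) D step] .
    also have "\<dots> = D * (a ^ i * nested_powers \<Phi> a 0 p)"
      using nested_powers_shift[OF \<Phi> hom a(1), of i 0 p] by simp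
    also have "\<dots> \<le> D * (a ^ i * max 1 C)"
      using D a nest by (intro mult_left_mono) auto
    finally show ?thesis
      by (simp add: mult_ac)
  qed
  have "semimetric_Cauchy d s"
    using D by (intro geometric_tail_imp_Cauchy[OF X sX a _ tail]) auto
  then obtain x where x: "x \<in> X" and lim: "semimetric_converges d s x"
    using assms(2) sX unfolding semimetric_complete_def by blast
  have Tx: "T x \<in> X"
    using assms(7) x by auto
  have lim_Suc: "semimetric_converges d (\<lambda>n. s (Suc n)) x"
    using lim unfolding semimetric_converges_def by (rule LIMSEQ_Suc)
  have lim_T: "semimetric_converges d (\<lambda>n. s (Suc n)) (T x)"
    unfolding semimetric_converges_def
  proof (rule tendsto_sandwich[OF _ _ tendsto_const])
    have "(\<lambda>n. \<alpha> * d (s n) x + \<beta> * (D * a ^ n)) \<longlonglongrightarrow> \<alpha> * 0 + \<beta> * (D * 0)"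
      using lim a LIMSEQ_power_zero[of a] unfolding semimetric_converges_def
      by (intro tendsto_intros) auto
    then show "(\<lambda>n. \<alpha> * d (s n) x + \<beta> * (D * a ^ n)) \<longlonglongrightarrow> 0"
      by simp
    have "d (s (Suc n)) (T x) \<le> \<alpha> * d (s n) x + \<beta> * (D * a ^ n)" for n
      using contr[OF s x, of n] mult_left_mono[OF step[of n] assms(10)] by (simp add: s_Suc)
    then show "\<forall>\<^sub>F n in sequentially.
        d (s (Suc n)) (T x) \<le> \<alpha> * d (s n) x + \<beta> * (D * a ^ n)"
      by simp
    show "\<forall>\<^sub>F n in sequentially. 0 \<le> d (s (Suc n)) (T x)"
      using d(1)[OF s Tx] by simp
  qed
  have "range (\<lambda>n. s (Suc n)) \<subseteq> X"
    using s by auto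
  then have fixed: "T x = x"
    using semimetric_converges_unique[OF X \<Phi> hom _ Tx x lim_T lim_Suc] by blast
  show ?thesis
  proof (rule ex1I[of _ x])
    show "x \<in> X \<and> T x = x"
      using x fixed by simp
    fix y
    assume y: "y \<in> X \<and> T y = y"
    then have "d x y \<le> \<alpha> * d x y"
      using contr[of x y] x fixed d(2)[of x x] by simp
    then have "(1 - \<alpha>) * d x y \<le> 0"
      by (simp add: algebra_simps)
    then have "d x y = 0"
      using assms(9) d(1)[of x y] x y by (auto simp: mult_le_0_iff)
    then show "y = x"
      using d(2)[of x y] x y by simp
  qed
qed

end
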